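(* Let $t,k,v,\lambda$ be positive integers with $k\ge t\ge 2$ and $v\ge 2$. Denote $p=1/v^t$ and $a=\sqrt{\frac{(1-p)^{2\lambda}-p^{2\lambda}}{1-2p}}$. Let \[ m=1+\frac{\lambda e}{(e-1)\log\frac{1}{1-p}}\left(1+\log\left(1+\frac{\left(\binom{k}{t}v^t a(1-p)\right)^{1/\lambda}}{\left(\log\frac{1}{1-p}\right)^{1-1/\lambda}}\right)\right). \] Then \[ \mathsf{CAN}_\lambda(t,k,v)\le m+\lambda\binom{k}{t}v^t\sum_{i=0}^{\lambda-1}\binom{m}{i}p^i(1-p)^{m-i}. \]
   Context: A covering array $\mathsf{CA}_\lambda(N;t,k,v)$ is an $N\times k$ array with entries from an alphabet $\Sigma$ of size $v$ such that for every set of $t$ distinct columns and every tuple $x\in\Sigma^t$, the tuple $x$ occurs as a row of the $N\times t$ subarray formed by those columns at least $\lambda$ times. $\mathsf{CAN}_\lambda(t,k,v)$ is the smallest $N$ for which a $\mathsf{CA}_\lambda(N;t,k,v)$ exists. $\log$ is the natural logarithm. For real $m$ and nonnegative integer $i$, $\binom{m}{i}=m(m-1)\cdots(m-i+1)/i!$. *)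

theory Defs
  imports Complex_Main
begin

text \<open>
  An array is a function taking a row index and a column index; only the rows below \<open>N\<close> and
  the columns below \<open>k\<close> are relevant.
\<close>

definition subarray_row :: "(nat \<Rightarrow> nat \<Rightarrow> 'a) \<Rightarrow> nat set \<Rightarrow> nat \<Rightarrow> 'a list" where
  "subarray_row A C r = map (A r) (sorted_list_of_set C)"

definition covering_array ::
  "nat \<Rightarrow> nat \<Rightarrow> nat \<Rightarrow> nat \<Rightarrow> 'a set \<Rightarrow> (nat \<Rightarrow> nat \<Rightarrow> 'a) \<Rightarrow> bool" where
  "covering_array l N t k \<Sigma> A \<longleftrightarrow>
     (\<forall>r<N. \<forall>c<k. A r c \<in> \<Sigma>) \<and>
     (\<forall>C x. C \<subseteq> {..<k} \<and> card C = t \<and> set x \<subseteq> \<Sigma> \<and> length x = t \<longrightarrow>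
        l \<le> card {r. r < N \<and> subarray_row A C r = x})"

text \<open>
  The existence of a covering array depends only on the size \<open>v\<close> of the alphabet, so the
  alphabet \<open>{..<v}\<close> is used.  For \<open>t \<le> k\<close> the set of admissible \<open>N\<close> is nonempty
  (list every row of \<open>{..<v}\<^sup>k\<close> sufficiently often), so the minimum is attained.
\<close>

definition CAN :: "nat \<Rightarrow> nat \<Rightarrow> nat \<Rightarrow> nat \<Rightarrow> nat" where
  "CAN l t k v = (LEAST N. \<exists>A :: nat \<Rightarrow> nat \<Rightarrow> nat. covering_array l N t k {..<v} A)"

end

theory Submission
  imports Defs "HOL-Library.FuncSet"
begin

text \<open>
  Already \<open>m\<close> alone bounds the covering array number, so the nonnegative sum plays no role.
  In a uniformly random array with \<open>n = \<lfloor>m\<rfloor>\<close> rows, the number of rows showing a given tuple on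
  given columns is binomial with parameters \<open>n\<close> and \<open>p\<close>. With \<open>q = 1 - p\<close>, \<open>L = ln (1 / q)\<close> and
  \<open>y = L n / l\<close>, Chernoff's bound estimates the probability that it is below \<open>l\<close> by
  \<open>z (e\<^bsup>1 - y\<^esup> / z)\<^bsup>l\<^esup>\<close>, where \<open>z = l q / (n p) = q L / (p y)\<close>. Since \<open>ln y \<le> y / e\<close>, the choice of
  \<open>m\<close> gives \<open>y - ln y \<ge> (1 - 1 / e) y \<ge> 1 + ln (1 + Q)\<close>, with \<open>Q\<close> the quotient inside the
  logarithm of \<open>m\<close>. This makes the bound smaller than \<open>1 / B\<close>, where \<open>B\<close> is the number of pairs
  of a column set and a tuple, and the union bound applies.
\<close>

section \<open>Random arrays: counting and the union bound\<close>

lemma card_PiE_restrict_eq: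
  fixes V :: "'b set"
  assumes "finite I" "C \<subseteq> I" "finite V" "h \<in> C \<rightarrow> V"
  shows "card {g \<in> I \<rightarrow>\<^sub>E V. \<forall>c\<in>C. g c = h c} = card V ^ (card I - card C)"
proof -
  have "{g \<in> I \<rightarrow>\<^sub>E V. \<forall>c\<in>C. g c = h c} = (\<Pi>\<^sub>E c\<in>I. if c \<in> C then {h c} else V)"
    using \<open>C \<subseteq> I\<close> funcset_mem[OF \<open>h \<in> C \<rightarrow> V\<close>]
    by (auto simp: set_eq_iff PiE_iff extensional_def split: if_splits)
  then have "card {g \<in> I \<rightarrow>\<^sub>E V. \<forall>c\<in>C. g c = h c} = (\<Prod>c\<in>I. card (if c \<in> C then {h c} else V))"
    by (simp add: card_PiE \<open>finite I\<close>)
  also have "\<dots> = (\<Prod>c\<in>I. if c \<in> C then 1 else card V)"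
    by (intro prod.cong) auto
  also have "\<dots> = card V ^ card (I - C)"
    using \<open>finite I\<close> by (simp add: prod.If_cases Diff_eq)
  also have "card (I - C) = card I - card C"
    using assms by (simp add: card_Diff_subset finite_subset)
  finally show ?thesis .
qed

lemma card_rows_with_subrow:
  fixes v k :: nat
  assumes "C \<subseteq> {..<k}" "set x \<subseteq> {..<v}" "length x = card C"
  shows "card {g \<in> {..<k} \<rightarrow>\<^sub>E {..<v}. map g (sorted_list_of_set C) = x} = v ^ (k - card C)"
proof -
  let ?s = "sorted_list_of_set C"
  have fin: "finite C" using assms(1) finite_subset by blast
  \<comment> \<open>\<open>h\<close> sends a column of \<open>C\<close> to the entry of
    \<open>x\<close> at its position in the sorted list; the position is unique because that list
    has no repetitions.\<close>
  define h where "h c = x ! (THE i. i < length ?s \<and> ?s ! i = c)" for c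
  have h: "h (?s ! i) = x ! i" if "i < length ?s" for i
  proof -
    have "(THE j. j < length ?s \<and> ?s ! j = ?s ! i) = i"
      using that by (intro the_equality) (auto simp: nth_eq_iff_index_eq)
    then show ?thesis by (simp add: h_def)
  qed
  have eq: "map g ?s = x \<longleftrightarrow> (\<forall>c\<in>C. g c = h c)" for g
  proof -
    have "map g ?s = x \<longleftrightarrow> (\<forall>i<length ?s. g (?s ! i) = h (?s ! i))"
      using assms(3) h by (auto simp: list_eq_iff_nth_eq)
    also have "\<dots> \<longleftrightarrow> (\<forall>c\<in>set ?s. g c = h c)"
      by (metis in_set_conv_nth)
    finally show ?thesis using fin by simp
  qed
  have "h \<in> C \<rightarrow> {..<v}"
  proof
    fix c assume "c \<in> C"
    then obtain i where "i < length ?s" "c = ?s ! i"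
      using fin by (metis in_set_conv_nth set_sorted_list_of_set)
    then show "h c \<in> {..<v}"
      using h assms(2,3) by (metis length_sorted_list_of_set nth_mem subsetD)
  qed
  then show ?thesis
    using card_PiE_restrict_eq[of "{..<k}" C "{..<v}" h] assms(1) by (simp add: eq)
qed

text \<open>After division by the number of arrays, this is the expectation of z^X for X binomial
  with parameters \<open>N\<close> and \<open>1 / v ^ card C\<close>: the rows are independent, so
  it splits into \<open>N\<close> equal factors, one per row.\<close>

lemma sum_power_count_subarray:
  fixes v k N :: nat and z :: real
  assumes "v \<ge> 1" "C \<subseteq> {..<k}" "set x \<subseteq> {..<v}" "length x = card C"
  shows "(\<Sum>A\<in>{..<N} \<rightarrow>\<^sub>E ({..<k} \<rightarrow>\<^sub>E {..<v}). z ^ card {r. r < N \<and> subarray_row A C r = x})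
          = (real v ^ k * (1 - 1 / real v ^ card C + z / real v ^ card C)) ^ N"
proof -
  let ?R = "{..<k} \<rightarrow>\<^sub>E {..<v}"
  let ?w = "\<lambda>g. if map g (sorted_list_of_set C) = x then z else 1"
  have fR: "finite ?R" by (simp add: finite_PiE)
  have cC: "card C \<le> k" using card_mono[OF _ assms(2)] by simp
  have "z ^ card {r. r < N \<and> subarray_row A C r = x} = (\<Prod>r<N. ?w (A r))" for A
  proof -
    have "{r. r < N \<and> subarray_row A C r = x} = {..<N} \<inter> {r. map (A r) (sorted_list_of_set C) = x}"
      by (auto simp: subarray_row_def)
    then show ?thesis by (simp add: prod.If_cases)
  qed
  then have "(\<Sum>A\<in>{..<N} \<rightarrow>\<^sub>E ?R. z ^ card {r. r < N \<and> subarray_row A C r = x})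
      = (\<Sum>A\<in>{..<N} \<rightarrow>\<^sub>E ?R. \<Prod>r<N. ?w (A r))" by simp
  also have "\<dots> = (\<Prod>r<N. \<Sum>g\<in>?R. ?w g)"
    by (rule prod_sum_PiE[symmetric]) (use fR in auto)
  also have "\<dots> = (\<Sum>g\<in>?R. ?w g) ^ N" by simp
  \<comment> \<open>Writing the weight as 1 plus \<open>z - 1\<close> on the matching rows leaves
    two cardinalities to count.\<close>
  also have "(\<Sum>g\<in>?R. ?w g) = (\<Sum>g\<in>?R. 1 + (if map g (sorted_list_of_set C) = x then z - 1 else 0))"
    by (intro sum.cong) auto
  also have "\<dots> = real (card ?R)
      + (z - 1) * real (card {g \<in> ?R. map g (sorted_list_of_set C) = x})"
    using fR by (simp add: sum.distrib sum.If_cases Int_def)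
  also have "\<dots> = real v ^ k + (z - 1) * real v ^ (k - card C)"
    using card_rows_with_subrow[OF assms(2-4)] by (simp add: card_PiE)
  also have "\<dots> = real v ^ k * (1 - 1 / real v ^ card C + z / real v ^ card C)"
    using assms(1) cC by (simp add: power_diff field_simps)
  finally show ?thesis .
qed

text \<open>A union bound in which the tail of the binomial distribution is estimated by Chernoff's
  method, with \<open>z\<close> the exponential of the (negative) Chernoff parameter.\<close>

lemma covering_array_exists:
  fixes v k t N l :: nat and z :: real
  assumes "v \<ge> 1" "0 < z" "z \<le> 1"
    and less: "real (k choose t) * real v ^ t * (1 - 1 / real v ^ t + z / real v ^ t) ^ N < z ^ (l - 1)"
  shows "\<exists>A. covering_array l N t k {..<v} A"
proof (rule ccontr)
  assume none: "\<not> ?thesis"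
  let ?AA = "{..<N} \<rightarrow>\<^sub>E ({..<k} \<rightarrow>\<^sub>E {..<v})"
  let ?T = "{C. C \<subseteq> {..<k} \<and> card C = t} \<times> {x. set x \<subseteq> {..<v} \<and> length x = t}"
  let ?n = "\<lambda>A C x. card {r. r < N \<and> subarray_row A C r = x}"
  let ?b = "1 - 1 / real v ^ t + z / real v ^ t"
  have fT: "finite ?T" by (intro finite_cartesian_product finite_lists_length_eq) auto
  have cT: "card ?T = (k choose t) * v ^ t"
    using n_subsets[of "{..<k}" t] card_lists_length_eq[of "{..<v}" t]
    by (simp add: card_cartesian_product)
  \<comment> \<open>A failing array has a pair occurring at most \<open>l - 1\<close> times; as
    \<open>z \<le> 1\<close>, that pair alone contributes at least \<open>z ^ (l - 1)\<close>, and
    the other terms are nonnegative.\<close>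
  have "z ^ (l - 1) \<le> (\<Sum>(C, x)\<in>?T. z ^ ?n A C x)" if "A \<in> ?AA" for A
  proof -
    have "\<forall>r<N. \<forall>c<k. A r c \<in> {..<v}" using that by (auto simp: PiE_iff)
    moreover have "\<not> covering_array l N t k {..<v} A" using none by blast
    ultimately have "\<not> (\<forall>C x. C \<subseteq> {..<k} \<and> card C = t \<and> set x \<subseteq> {..<v} \<and> length x = t \<longrightarrow>
        l \<le> ?n A C x)"
      unfolding covering_array_def by simp
    then obtain C and x :: "nat list" where "C \<subseteq> {..<k}" "card C = t" "set x \<subseteq> {..<v}" "length x = t"
      and c: "?n A C x < l"
      by (auto simp: not_le)
    then have "(C, x) \<in> ?T" by simp
    from member_le_sum[OF this _ fT, of "\<lambda>(C, x). z ^ ?n A C x"]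
    have "z ^ ?n A C x \<le> (\<Sum>(C, x)\<in>?T. z ^ ?n A C x)" using \<open>0 < z\<close> by auto
    moreover have "z ^ (l - 1) \<le> z ^ ?n A C x"
      using c assms(2,3) by (intro power_decreasing) auto
    ultimately show ?thesis by linarith
  qed
  \<comment> \<open>Summing over all arrays and exchanging the sums brings in the closed form, and
    \<open>less\<close> makes the total too small.\<close>
  then have "real (card ?AA) * z ^ (l - 1) \<le> (\<Sum>A\<in>?AA. \<Sum>(C, x)\<in>?T. z ^ ?n A C x)"
    by (intro sum_bounded_below) auto
  also have "\<dots> = (\<Sum>(C, x)\<in>?T. \<Sum>A\<in>?AA. z ^ ?n A C x)"
    by (subst sum.swap) (simp add: case_prod_unfold)
  also have "\<dots> = (\<Sum>(C, x)\<in>?T. (real v ^ k * ?b) ^ N)"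
    by (intro sum.cong refl) (auto simp: sum_power_count_subarray[OF \<open>v \<ge> 1\<close>])
  also have "\<dots> = real (card ?T) * (real v ^ k * ?b) ^ N" by (simp add: case_prod_unfold)
  also have "\<dots> = (real v ^ k) ^ N * (real (k choose t) * real v ^ t * ?b ^ N)"
    by (simp add: cT power_mult_distrib)
  also have "\<dots> < (real v ^ k) ^ N * z ^ (l - 1)"
    using less \<open>v \<ge> 1\<close> by simp
  also have "(real v ^ k) ^ N = real (card ?AA)" by (simp add: card_PiE)
  finally show False by simp
qed

lemma CAN_le:
  "covering_array l N t k {..<v} A \<Longrightarrow> CAN l t k v \<le> N"
  unfolding CAN_def by (rule Least_le) blast

section \<open>Real estimates for the Chernoff bound\<close>

lemma minus_ln_one_minus_bounds:
  fixes p :: real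
  assumes "0 < p" "p < 1"
  shows "p \<le> ln (1 / (1 - p))" "ln (1 / (1 - p)) \<le> p / (1 - p)"
proof -
  show "p \<le> ln (1 / (1 - p))"
    using ln_le_minus_one[of "1 - p"] assms by (simp add: ln_div)
  have "ln (1 / (1 - p)) \<le> 1 / (1 - p) - 1"
    using assms by (intro ln_le_minus_one) auto
  also have "\<dots> = p / (1 - p)" using assms by (simp add: field_simps)
  finally show "ln (1 / (1 - p)) \<le> p / (1 - p)" .
qed

text \<open>The tangent of \<open>ln\<close> at e gives ln y \<le> y / e, hence y - ln y \<ge> (1 -
  1 / e) y; the constant \<open>exp 1 / (exp 1 - 1)\<close> is the inverse of 1 - 1 / e.\<close>

lemma exp_one_minus_le:
  fixes y Q :: real
  assumes "y > 0" "Q \<ge> 0" and y: "y \<ge> exp 1 / (exp 1 - 1) * (1 + ln (1 + Q))"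
  shows "exp (1 - y) \<le> 1 / (y * (1 + Q))"
proof -
  have e: "exp 1 > (1::real)" by simp
  have "ln (y / exp 1) \<le> y / exp 1 - 1"
    using \<open>y > 0\<close> by (intro ln_le_minus_one) auto
  then have "ln y \<le> y / exp 1" using \<open>y > 0\<close> by (simp add: ln_div)
  moreover have "1 + ln (1 + Q) \<le> y * (1 - 1 / exp 1)"
    using y e by (simp add: field_simps)
  ultimately have "1 - y \<le> - ln (y * (1 + Q))"
    using assms(1,2) by (simp add: ln_mult right_diff_distrib)
  then have "exp (1 - y) \<le> exp (- ln (y * (1 + Q)))" by simp
  also have "\<dots> = 1 / (y * (1 + Q))"
    using assms(1,2) by (simp add: exp_minus inverse_eq_divide)
  finally show ?thesis .
qed

text \<open>The radicand is the geometric sum of (1 - p)^(2 (l - 1 - i)) p^(2 i) over i < l, whose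
  term for i = 0 is the square of the left-hand side.\<close>

lemma power_le_sqrt_geometric:
  fixes p :: real
  assumes "0 < p" "p < 1 / 2" "l \<ge> 1"
  shows "(1 - p) ^ (l - 1) \<le> sqrt (((1 - p) ^ (2 * l) - p ^ (2 * l)) / (1 - 2 * p))"
proof (rule real_le_rsqrt)
  obtain j where j: "l = Suc j" using assms(3) by (cases l) auto
  have "p ^ (2 * j) \<le> (1 - p) ^ (2 * j)" using assms by (intro power_mono) auto
  then have "p ^ 2 * p ^ (2 * j) \<le> p ^ 2 * (1 - p) ^ (2 * j)" by (intro mult_left_mono) auto
  then have "(1 - p) ^ (2 * j) * (1 - 2 * p) \<le> (1 - p) ^ (2 * l) - p ^ (2 * l)"
    by (simp add: j power2_eq_square algebra_simps)
  then show "((1 - p) ^ (l - 1))\<^sup>2 \<le> ((1 - p) ^ (2 * l) - p ^ (2 * l)) / (1 - 2 * p)"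
    using assms by (simp add: j field_simps power_mult[symmetric] mult.commute)
qed

text \<open>With q = 1 - p, the power (1 - p + z p)^n is at most q^n exp (n p z / q), and this
  \<open>z\<close> minimises that bound divided by z^l. The exponent \<open>l - 1\<close> leaves a
  spare factor z \<le> 1 / 2, which yields strictness.\<close>

lemma chernoff_parameter_works:
  fixes p B Q L y :: real and l n :: nat
  assumes p: "0 < p" "p \<le> 1 / 4" and l: "l \<ge> 1" and B: "B > 0"
    and L: "L = ln (1 / (1 - p))" and n: "n \<ge> 1" and y: "y = L * real n / real l"
    and y2: "y \<ge> 2" and Q: "Q > 0" "B * (1 - p) ^ l \<le> L ^ (l - 1) * Q ^ l"
    and exp_y: "exp (1 - y) \<le> 1 / (y * (1 + Q))"
  defines "z \<equiv> real l * (1 - p) / (real n * p)"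
  shows "0 < z" "z \<le> 1" "B * (1 - p + z * p) ^ n < z ^ (l - 1)"
proof -
  define q where "q = 1 - p"
  have q: "q \<ge> 3 / 4" "q < 1" using p by (auto simp: q_def)
  have Lb: "p \<le> L" "L \<le> p / q"
    using minus_ln_one_minus_bounds[of p] p by (auto simp: L q_def)
  have L0: "L > 0" using Lb p by linarith
  show z0: "0 < z" using p l n by (auto simp: z_def)
  have zy: "z = q * L / (p * y)"
    using p l n L0 by (simp add: z_def y q_def field_simps)
  have "q * L \<le> p" using Lb q by (simp add: field_simps)
  then have "z \<le> 1 / y" using p y2 by (simp add: zy field_simps)
  moreover have "1 / y \<le> 1 / 2" using y2 by (simp add: field_simps)
  ultimately have z2: "z \<le> 1 / 2" by linarith
  then show "z \<le> 1" by simp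
  have pq: "p \<le> q\<^sup>2"
  proof -
    have "(3/4)\<^sup>2 \<le> q\<^sup>2" using q by (intro power_mono) auto
    then show ?thesis using p by (simp add: power2_eq_square)
  qed
  have "1 - p + z * p = q * (1 + real l / real n)"
    using p n by (simp add: z_def q_def field_simps)
  then have "(1 - p + z * p) ^ n = q ^ n * (1 + real l / real n) ^ n"
    by (simp add: power_mult_distrib)
  also have "\<dots> \<le> q ^ n * exp (real l / real n) ^ n"
    using q by (intro mult_left_mono power_mono exp_ge_add_one_self) auto
  also have "q = exp (- L)" using q by (simp add: L q_def ln_div)
  also have "exp (- L) ^ n * exp (real l / real n) ^ n = exp (real l * (1 - y))"
    using n l by (simp add: exp_of_nat_mult[symmetric] exp_add[symmetric] y algebra_simps)
  also have "\<dots> = exp (1 - y) ^ l" by (simp add: exp_of_nat_mult)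
  also have "\<dots> \<le> (1 / (y * (1 + Q))) ^ l" by (intro power_mono exp_y) auto
  \<comment> \<open>Passing from 1 + Q to Q produces the power \<open>Q ^ l\<close> for which a
    lower bound is assumed.\<close>
  also have "\<dots> \<le> (1 / (y * Q)) ^ l"
    using y2 Q by (intro power_mono divide_left_mono mult_left_mono mult_pos_pos) auto
  finally have 1: "B * (1 - p + z * p) ^ n \<le> B * (1 / (y * Q)) ^ l"
    using B by simp
  \<comment> \<open>The slack: z \<le> 1 / 2 < 9 / 16 \<le> q^2, while L / p and q^2 / p are at
    least 1.\<close>
  have "z < q\<^sup>2 * 1 * 1"
  proof -
    have "(3/4)\<^sup>2 \<le> q\<^sup>2" using q by (intro power_mono) auto
    then show ?thesis using z2 by (simp add: power2_eq_square)
  qed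
  also have "\<dots> \<le> q\<^sup>2 * (L / p) * (q\<^sup>2 / p) ^ (l - 1)"
    using Lb p pq q by (intro mult_mono one_le_power) auto
  finally have zz: "z < q\<^sup>2 * (L / p) * (q\<^sup>2 / p) ^ (l - 1)" .
  obtain j where j: "l = Suc j" using l by (cases l) auto
  \<comment> \<open>Multiplying by \<open>B\<close> lets the hypothesis on \<open>Q\<close> enter;
    the factors then regroup into powers of z y = q L / p.\<close>
  have "z * B < (q\<^sup>2 * (L / p) * (q\<^sup>2 / p) ^ (l - 1)) * B"
    using zz B by (rule mult_strict_right_mono)
  also have "\<dots> = (q / p) ^ l * L * (B * q ^ l)"
    by (simp add: j power_divide power2_eq_square power_mult_distrib)
  also have "\<dots> \<le> (q / p) ^ l * L * (L ^ (l - 1) * Q ^ l)"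
    using Q q p L0 by (intro mult_left_mono) (auto simp: q_def)
  also have "\<dots> = (q * L / p) ^ l * Q ^ l"
    by (simp add: j power_divide power_mult_distrib)
  also have "q * L / p = z * y" using p y2 by (simp add: zy)
  finally have "z * B < z * (z ^ j * (y * Q) ^ l)"
    by (simp add: j power_mult_distrib mult_ac)
  then have "B < z ^ j * (y * Q) ^ l" using z0 by simp
  then have "B * (1 / (y * Q)) ^ l < z ^ (l - 1)"
    using y2 Q by (simp add: j power_divide pos_divide_less_eq)
  with 1 show "B * (1 - p + z * p) ^ n < z ^ (l - 1)" by linarith
qed

section \<open>Choice of the number of rows and the final bound\<close>

theorem theorem6p3:
  fixes t k v l :: nat and p a m :: real
  assumes "l \<ge> 1" and "t \<ge> 2" and "k \<ge> t" and "v \<ge> 2"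
    and "p = 1 / real v ^ t"
    and "a = sqrt (((1 - p) ^ (2 * l) - p ^ (2 * l)) / (1 - 2 * p))"
    and "m = 1 + real l * exp 1 / ((exp 1 - 1) * ln (1 / (1 - p))) *
               (1 + ln (1 + (real (k choose t) * real v ^ t * a * (1 - p)) powr (1 / real l)
                            / ln (1 / (1 - p)) powr (1 - 1 / real l)))"
  shows "real (CAN l t k v) \<le>
           m + real l * real (k choose t) * real v ^ t *
                 (\<Sum>i = 0..l - 1. (m gchoose i) * p ^ i * (1 - p) powr (m - real i))"
proof -
  define L where "L = ln (1 / (1 - p))"
  define B where "B = real (k choose t) * real v ^ t"
  define Q where "Q = (B * a * (1 - p)) powr (1 / real l) / L powr (1 - 1 / real l)"
  define n where "n = nat \<lfloor>m\<rfloor>"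
  define y where "y = L * real n / real l"
  have "(2::real) ^ 2 \<le> 2 ^ t" using assms(2) by (intro power_increasing) auto
  also have "\<dots> \<le> real v ^ t" using assms(4) by (intro power_mono) auto
  finally have "4 \<le> real v ^ t" by simp
  then have p: "0 < p" "p \<le> 1 / 4"
    unfolding assms(5) using assms(4) by (auto simp: divide_le_eq)
  have Lb: "p \<le> L" "L \<le> p / (1 - p)"
    using minus_ln_one_minus_bounds[of p] p by (auto simp: L_def)
  have L0: "L > 0" using Lb p by linarith
  have "p / (1 - p) \<le> 1 / 3" using p by (simp add: field_simps)
  then have L3: "L \<le> 1 / 3" using Lb by linarith
  have "k choose t \<ge> 1" using assms(3) by (simp add: Suc_leI)
  then have "B \<ge> 1 * real v ^ t" unfolding B_def by (intro mult_right_mono) auto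
  then have Bp: "B \<ge> 1 / p" by (simp add: assms(5))
  then have B0: "B > 0" using p by (smt (verit) divide_pos_pos)
  have a: "(1 - p) ^ (l - 1) \<le> a"
    using power_le_sqrt_geometric[of p l] p assms(1) by (simp add: assms(6))
  have a0: "a > 0" using less_le_trans[OF zero_less_power a] p by simp
  have Q0: "Q > 0" using B0 a0 p L0 by (auto simp: Q_def)
  have l1: "real l * (1 - 1 / real l) = real l - 1"
    using assms(1) by (simp add: field_simps)
  \<comment> \<open>The \<open>l\<close>-th power undoes the exponents 1 / l and 1 - 1 / l in
    \<open>Q\<close>.\<close>
  have Ql: "L ^ (l - 1) * Q ^ l = B * a * (1 - p)"
  proof -
    have "L powr (real l - 1) = L ^ (l - 1)"
      using powr_realpow[OF L0, of "l - 1"] assms(1) by (simp add: of_nat_diff)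
    then have "Q ^ l = (B * a * (1 - p)) / L ^ (l - 1)"
      using B0 a0 p L0 assms(1) l1
      by (simp add: Q_def power_divide powr_power mult.commute)
    then show ?thesis using L0 by simp
  qed
  have Qge: "B * (1 - p) ^ l \<le> L ^ (l - 1) * Q ^ l"
  proof -
    have "(1 - p) ^ l = (1 - p) ^ (l - 1) * (1 - p)"
      using assms(1) by (cases l) auto
    also have "\<dots> \<le> a * (1 - p)" using a p by (intro mult_right_mono) auto
    finally show ?thesis unfolding Ql using B0 by (simp add: mult.assoc)
  qed
  \<comment> \<open>This serves to get 1 + Q \<ge> 3 \<ge> e below. It is checked on l-th powers of
    L Q, with B L \<ge> 1 because B \<ge> 1 / p and L \<ge> p.\<close>
  have Q2: "Q \<ge> 2"
  proof -
    have "L * 2 \<le> 1 - p" using L3 p by simp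
    then have "(L * 2) ^ l \<le> 1 * (1 - p) ^ l" 
      unfolding mult_1 using L0 by (intro power_mono) auto
    also have "\<dots> \<le> (B * L) * (1 - p) ^ l"
    proof (intro mult_right_mono)
      have "1 / p * p \<le> B * L" using Bp Lb p B0 by (intro mult_mono) auto
      then show "1 \<le> B * L" using p by simp
    qed (use p in auto)
    also have "\<dots> = L * (B * (1 - p) ^ l)" by simp
    also have "\<dots> \<le> L * (L ^ (l - 1) * Q ^ l)" using Qge L0 by (intro mult_left_mono) auto
    also have "\<dots> = (L * Q) ^ l" using assms(1) by (cases l) (auto simp: power_mult_distrib)
    finally have "L * 2 \<le> L * Q"
      using L0 Q0 assms(1) by (subst (asm) power_mono_iff) auto
    then show ?thesis using L0 by simp
  qed
  \<comment> \<open>\<open>c\<close> is the lower bound on \<open>y\<close> that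
    \<open>exp_one_minus_le\<close> asks for; \<open>m\<close> is 1 plus the real number of rows at
    which \<open>y\<close> would equal \<open>c\<close>.\<close>
  define c :: real where "c = exp 1 / (exp 1 - 1) * (1 + ln (1 + Q))"
  have c2: "c \<ge> 2"
  proof -
    have e1: "exp 1 > (1::real)" by simp
    have "exp 1 \<le> 1 + Q" using exp_le Q2 by linarith
    then have "ln (1 + Q) \<ge> 1" using Q0 by (subst ln_ge_iff) auto
    moreover have "exp 1 / (exp 1 - 1) \<ge> (1::real)" using e1 by (simp add: field_simps)
    ultimately have "1 * 2 \<le> c" unfolding c_def by (intro mult_mono) auto
    then show ?thesis by simp
  qed
  have m: "m = 1 + real l * c / L"
    by (simp add: assms(7) c_def Q_def B_def L_def)
  have lm: "real l * c / L \<ge> real l"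
  proof -
    have "real l * L \<le> real l * c" using L3 c2 by (intro mult_left_mono) auto
    then show ?thesis using L0 by (simp add: field_simps)
  qed
  \<comment> \<open>The summand 1 in \<open>m\<close> absorbs the rounding down: m - 1 \<le>
    n.\<close>
  have n: "real n \<le> m" "real l * c / L \<le> real n"
    using lm m by (auto simp: n_def) linarith
  have n1: "n \<ge> 1" using n(2) lm assms(1) by linarith
  have yc: "y \<ge> c" using n(2) L0 assms(1) by (simp add: y_def field_simps)
  have y2: "y \<ge> 2" using yc c2 by linarith
  have "exp (1 - y) \<le> 1 / (y * (1 + Q))"
    using yc y2 Q0 by (intro exp_one_minus_le) (auto simp: c_def)
  note z = chernoff_parameter_works[OF p assms(1) B0 L_def n1 y_def y2 Q0 Qge this]
  have "\<exists>A. covering_array l n t k {..<v} A"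
    using z assms(4)
    by (intro covering_array_exists[where z = "real l * (1 - p) / (real n * p)"])
       (auto simp: B_def assms(5))
  then have "real (CAN l t k v) \<le> m"
    using CAN_le n(1) by (metis le_trans of_nat_le_iff order.trans)
  \<comment> \<open>Here i \<le> l - 1 < m, so all factors m - j with j < i of the generalised
    binomial coefficient are nonnegative.\<close>
  moreover have "0 \<le> (\<Sum>i = 0..l - 1. (m gchoose i) * p ^ i * (1 - p) powr (m - real i))"
  proof (intro sum_nonneg mult_nonneg_nonneg)
    fix i assume "i \<in> {0..l - 1}"
    then have "real i \<le> m" using lm m by auto
    then show "0 \<le> m gchoose i"
      by (auto simp: gbinomial_prod_rev intro!: divide_nonneg_nonneg prod_nonneg)
  qed (use p in auto)
  ultimately show ?thesis by (simp add: add_increasing2)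
qed

end
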